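(* Let $m\ge 1$ and let $\{A^{[t]}=(a_{ij}^{[t]})_{i,j=1}^m,\ t\geq 0\}$ be a family of real $m\times m$ matrices, each of which is invertible, and let $(A^{[t]})^{-1}=(b_{ij}^{[t]})$ denote the inverse of $A^{[t]}$. Assume that $\gamma_{ijk}^{(t)}$, $i,j,k=1,\dots,m$, are arbitrary real functions of $t\ge 0$ such that \[\sum_{j=1}^m\gamma_{ijk}^{(t)}=b_{ik}^{[t]}\qquad\text{for all } i,k \text{ and all } t\ge 0.\] Then the cubic matrices \[\mathcal M^{[s,t]}=\left(\sum_{k=1}^m a_{ik}^{[s]}\gamma_{kjr}^{(t)}\right)_{i,j,r=1}^m,\qquad 0\le s\le t,\] generate a flow of algebras of type (E).
   Context: A (real) cubic matrix of size $m$ is an array $A=(a_{ijk})_{i,j,k=1}^m$ with real entries. Multiplication of type (E): for cubic matrices $A=(a_{ijk})$, $B=(b_{ijk})$, the product $C=AB=(c_{inr})$ has entries $c_{inr}=\sum_{j,k=1}^m a_{ijk}b_{knr}$. A family $\{\mathcal A^{[s,t]}: s,t\in\mathbb R,\ 0\le s\le t\}$ of $m$-dimensional real algebras with basis $e_1,\dots,e_m$ and multiplication $e_ie_j=\sum_{k=1}^m c_{ijk}^{[s,t]}e_k$ is called a flow of algebras (FA) of type (E) if the cubic matrices of structural constants $\mathcal M^{[s,t]}=(c_{ijk}^{[s,t]})_{i,j,k=1}^m$ satisfy the Kolmogorov-Chapman equation $\mathcal M^{[s,t]}=\mathcal M^{[s,\tau]}\mathcal M^{[\tau,t]}$ for all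 $0\le s<\tau<t$, the product being the multiplication of type (E). A family of cubic matrices generates an FA of type (E) if the algebras having these matrices as structural constants form an FA of type (E). *)

theory Defs
  imports "HOL-Analysis.Analysis"
begin

text \<open>Indices range over an arbitrary nonempty finite type; its cardinality is the size \<open>m\<close>.
  The entry \<open>a\<^sub>i\<^sub>j\<^sub>k\<close> is \<open>A $ i $ j $ k\<close>.\<close>

type_synonym 'm cubic_matrix = "real ^ 'm ^ 'm ^ 'm"

definition mult_E :: "('m::finite) cubic_matrix \<Rightarrow> 'm cubic_matrix \<Rightarrow> 'm cubic_matrix" where
  "mult_E A B = (\<chi> i n r. \<Sum>j\<in>UNIV. \<Sum>k\<in>UNIV. A $ i $ j $ k * B $ k $ n $ r)"

text \<open>An \<open>m\<close>-dimensional real algebra with a distinguished basis is a bilinear product on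
  \<open>real ^ 'm\<close>, the basis \<open>e\<^sub>i\<close> being \<open>axis i 1\<close>; associativity, commutativity and a unit are not
  required.\<close>

definition struct_consts :: "(real ^ 'm \<Rightarrow> real ^ 'm \<Rightarrow> real ^ 'm) \<Rightarrow> ('m::finite) cubic_matrix" where
  "struct_consts p = (\<chi> i j k. p (axis i 1) (axis j 1) $ k)"

definition algebra_of :: "('m::finite) cubic_matrix \<Rightarrow> real ^ 'm \<Rightarrow> real ^ 'm \<Rightarrow> real ^ 'm" where
  "algebra_of C x y = (\<chi> k. \<Sum>i\<in>UNIV. \<Sum>j\<in>UNIV. x $ i * y $ j * C $ i $ j $ k)"

text \<open>\<open>algebra_of C\<close> is the unique algebra whose matrix of structural constants is \<open>C\<close>.\<close>

lemma bilinear_algebra_of: "bilinear (algebra_of C)"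
  unfolding bilinear_def algebra_of_def
  by (auto intro!: linearI simp: vec_eq_iff algebra_simps sum.distrib sum_distrib_left)

lemma struct_consts_algebra_of: "struct_consts (algebra_of C) = C"
  by (simp add: struct_consts_def algebra_of_def axis_def vec_eq_iff
      if_distrib[where f = "\<lambda>x. x * _"] sum.If_cases cong: if_cong)

lemma algebra_of_struct_consts:
  assumes "bilinear p"
  shows "algebra_of (struct_consts p) = p"
proof (intro ext)
  fix x y :: "real ^ 'a"
  have "p x y = p (\<Sum>i\<in>UNIV. x $ i *\<^sub>R axis i 1) (\<Sum>j\<in>UNIV. y $ j *\<^sub>R axis j 1)"
    using basis_expansion[of x] basis_expansion[of y]
    by (simp add: scalar_mult_eq_scaleR)
  also have "\<dots> = (\<Sum>(i, j)\<in>UNIV \<times> UNIV. p (x $ i *\<^sub>R axis i 1) (y $ j *\<^sub>R axis j 1))"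
    by (rule bilinear_sum[OF assms])
  also have "\<dots> = algebra_of (struct_consts p) x y"
    by (simp add: vec_eq_iff algebra_of_def struct_consts_def sum.cartesian_product[symmetric]
        bilinear_lmul[OF assms] bilinear_rmul[OF assms] mult.assoc mult.left_commute del: UNIV_Times_UNIV)
  finally show "algebra_of (struct_consts p) x y = p x y" ..
qed

text \<open>A family indexed by \<open>0 \<le> s \<le> t\<close> is a function of \<open>s\<close> and \<open>t\<close> whose values elsewhere are
  ignored.\<close>

definition flow_of_algebras_E ::
    "(real \<Rightarrow> real \<Rightarrow> real ^ 'm \<Rightarrow> real ^ 'm \<Rightarrow> real ^ ('m::finite)) \<Rightarrow> bool" where
  "flow_of_algebras_E p \<longleftrightarrow>
     (\<forall>s t. 0 \<le> s \<and> s \<le> t \<longrightarrow> bilinear (p s t)) \<and>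
     (\<forall>s \<tau> t. 0 \<le> s \<and> s < \<tau> \<and> \<tau> < t \<longrightarrow>
        struct_consts (p s t) = mult_E (struct_consts (p s \<tau>)) (struct_consts (p \<tau> t)))"

definition generates_FA_E :: "(real \<Rightarrow> real \<Rightarrow> ('m::finite) cubic_matrix) \<Rightarrow> bool" where
  "generates_FA_E M \<longleftrightarrow> flow_of_algebras_E (\<lambda>s t. algebra_of (M s t))"

end

theory Submission
  imports Defs
begin

text \<open>The \<open>n\<close>-th middle slice of a cubic matrix is the square matrix obtained by fixing its
  second index to \<open>n\<close>. In a product of type (E) the second index of the left factor is summed
  over with nothing coupled to it, and the second index of the right factor is carried along.
  So the slices of \<open>mult_E C D\<close> are ordinary matrix products: the sum of all middle slices of
  \<open>C\<close>, times a slice of \<open>D\<close>.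

  If \<open>\<Gamma>\<^sub>n(t)\<close> denotes the matrix \<open>(\<gamma>\<^sub>k\<^sub>n\<^sub>r(t))\<^sub>k\<^sub>r\<close>, then the cubic matrix at \<open>(s, t)\<close> has the slices
  \<open>A(s) \<Gamma>\<^sub>n(t)\<close>, and the hypothesis on \<open>\<gamma>\<close> says that \<open>\<Gamma>\<^sub>n(t)\<close> sums over \<open>n\<close> to the inverse of
  \<open>A(t)\<close>. The Kolmogorov-Chapman equation thus telescopes slice by slice:
  \<open>A(s) A(\<tau>)\<^sup>-\<^sup>1 \<cdot> A(\<tau>) \<Gamma>\<^sub>n(t) = A(s) \<Gamma>\<^sub>n(t)\<close>.\<close>

definition middle_slice :: "('m::finite) cubic_matrix \<Rightarrow> 'm \<Rightarrow> real ^ 'm ^ 'm" where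
  "middle_slice C n = (\<chi> i r. C $ i $ n $ r)"

lemma cubic_matrix_eqI:
  assumes "\<And>n. middle_slice C n = middle_slice D n"
  shows "C = D"
  using assms by (simp add: middle_slice_def vec_eq_iff)

lemma middle_slice_mult_E:
  "middle_slice (mult_E C D) n = (\<Sum>j\<in>UNIV. middle_slice C j) ** middle_slice D n"
proof -
  have "(\<Sum>j\<in>UNIV. \<Sum>k\<in>UNIV. C $ i $ j $ k * D $ k $ n $ r)
      = (\<Sum>k\<in>UNIV. (\<Sum>j\<in>UNIV. C $ i $ j $ k) * D $ k $ n $ r)" for i r
    by (subst sum.swap) (simp add: sum_distrib_right)
  then show ?thesis
    by (simp add: middle_slice_def mult_E_def matrix_matrix_mult_def vec_eq_iff sum_component)
qed

lemma matrix_mult_sum_right: "B ** (\<Sum>j\<in>J. G j) = (\<Sum>j\<in>J. B ** G j)"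
  for B :: "real ^ 'n ^ 'm" and G :: "'j \<Rightarrow> real ^ 'k ^ 'n"
  by (induction J rule: infinite_finite_induct)
    (simp_all add: matrix_add_ldistrib)

lemma matrix_inv_mult_left:
  assumes "invertible B"
  shows "matrix_inv B ** B = mat 1"
  using someI_ex[OF assms[unfolded invertible_def]] by (simp add: matrix_inv_def)

lemma generates_FA_E_iff:
  "generates_FA_E M \<longleftrightarrow>
     (\<forall>s \<tau> t. 0 \<le> s \<and> s < \<tau> \<and> \<tau> < t \<longrightarrow> M s t = mult_E (M s \<tau>) (M \<tau> t))"
  by (simp add: generates_FA_E_def flow_of_algebras_E_def bilinear_algebra_of
      struct_consts_algebra_of)

theorem theorem2:
  fixes A :: "real \<Rightarrow> real ^ 'm ^ ('m::finite)"
    and \<gamma> :: "'m \<Rightarrow> 'm \<Rightarrow> 'm \<Rightarrow> real \<Rightarrow> real"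
  assumes "\<And>t. t \<ge> 0 \<Longrightarrow> invertible (A t)"
    and "\<And>i k t. t \<ge> 0 \<Longrightarrow> (\<Sum>j\<in>UNIV. \<gamma> i j k t) = matrix_inv (A t) $ i $ k"
  shows "generates_FA_E (\<lambda>s t. \<chi> i j r. \<Sum>k\<in>UNIV. A s $ i $ k * \<gamma> k j r t)"
proof -
  define M :: "real \<Rightarrow> real \<Rightarrow> 'm cubic_matrix"
    where "M s t = (\<chi> i j r. \<Sum>k\<in>UNIV. A s $ i $ k * \<gamma> k j r t)" for s t
  define \<Gamma> :: "real \<Rightarrow> 'm \<Rightarrow> real ^ 'm ^ 'm"
    where "\<Gamma> t n = (\<chi> k r. \<gamma> k n r t)" for t n
  have slice: "middle_slice (M s t) n = A s ** \<Gamma> t n" for s t n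
    by (simp add: M_def \<Gamma>_def middle_slice_def matrix_matrix_mult_def)
  have sum_\<Gamma>: "(\<Sum>n\<in>UNIV. \<Gamma> t n) = matrix_inv (A t)" if "t \<ge> 0" for t
    using assms(2)[OF that] by (simp add: \<Gamma>_def vec_eq_iff sum_component)
  have chapman: "M s t = mult_E (M s \<tau>) (M \<tau> t)" if "0 \<le> s" "s < \<tau>" for s \<tau> t
  proof (rule cubic_matrix_eqI)
    fix n
    have \<tau>: "0 \<le> \<tau>" using that by simp
    have "middle_slice (mult_E (M s \<tau>) (M \<tau> t)) n = (A s ** matrix_inv (A \<tau>)) ** (A \<tau> ** \<Gamma> t n)"
      by (simp add: middle_slice_mult_E slice sum_\<Gamma>[OF \<tau>] flip: matrix_mult_sum_right)
    also have "\<dots> = A s ** (matrix_inv (A \<tau>) ** A \<tau>) ** \<Gamma> t n"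
      by (simp add: matrix_mul_assoc)
    also have "\<dots> = middle_slice (M s t) n"
      by (simp add: matrix_inv_mult_left[OF assms(1)[OF \<tau>]] slice)
    finally show "middle_slice (M s t) n = middle_slice (mult_E (M s \<tau>) (M \<tau> t)) n" ..
  qed
  have "generates_FA_E M"
    unfolding generates_FA_E_iff using chapman by blast
  then show ?thesis
    unfolding M_def .
qed

end
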